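(* Let $\mathcal E\subset\mathcal E'\subset\mathcal Y^2$ be two edge sets such that both $\mathcal W_\kappa(\mathcal Y,\mathcal E)$ and $\mathcal W_\kappa(\mathcal Y,\mathcal E')$ are non-empty. If $\mathcal W_\kappa(\mathcal Y,\mathcal E')$ forms an e-family, then $\mathcal W_\kappa(\mathcal Y,\mathcal E)$ forms an e-family.
   Context: Let $\mathcal Y$ be a finite set and $\kappa\colon\mathcal Y\to\mathcal X$ a surjective map; $\mathcal S_x=\kappa^{-1}(x)$. All edge sets are nonempty subsets of $\mathcal Y^2$ (here both $\mathcal E$ and $\mathcal E'$) such that the corresponding digraph on $\mathcal Y$ is strongly connected. For such an edge set $\mathcal E$: $\mathcal F(\mathcal Y,\mathcal E)=\mathbb R^{\mathcal E}$ is the space of real functions on $\mathcal E$, identified with real $\mathcal Y\times\mathcal Y$ matrices vanishing outside $\mathcal E$; $\mathcal F^+(\mathcal Y,\mathcal E)$ is the subset of those that are strictly positive on $\mathcal E$; $\mathcal W(\mathcal Y,\mathcal E)\subset\mathcal F^+(\mathcal Y,\mathcal E)$ is the set of row-stochastic ones. $\mathcal D=\{(\kappa(y),\kappa(y')):(y,y')\in\mathcal E\}$, $F(y,\mathcal S_{x'})=\sum_{y'\in\mathcal S_{x'}}F(y,y')$, and $\mathcal W_\kappa(\mathcal Y,\mathcal E)$ is the set of $\kappa$-lumpable $P\in\mathcal W(\mathcal Y,\mathcal E)$, i.e. those with $P(y_1,\mathcal S_{x'})=P(y_2,\mathcal S_{x'})$ for all $(x,x')\in\mathcal D$ and $y_1,y_2\in\mathcal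 S_x$. E-families: for $F\in\mathcal F^+(\mathcal Y,\mathcal E)$ with Perron–Frobenius root $\rho_F$ and positive right eigenvector $v_F$, put $\mathfrak s(F)(y,y')=\frac{F(y,y')v_F(y')}{\rho_F v_F(y)}$, so $\mathfrak s(F)\in\mathcal W(\mathcal Y,\mathcal E)$. Let $\mathcal N(\mathcal Y,\mathcal E)$ be the linear space of $N\in\mathcal F(\mathcal Y,\mathcal E)$ of the form $N(y,y')=f(y')-f(y)+c$ with $f\in\mathbb R^{\mathcal Y}$, $c\in\mathbb R$. A set $\mathcal V\subset\mathcal W(\mathcal Y,\mathcal E)$ forms an e-family (of dimension $d\ge 0$) if there are $K\in\mathcal F(\mathcal Y,\mathcal E)$ and $G_1,\dots,G_d\in\mathcal F(\mathcal Y,\mathcal E)$, linearly independent modulo $\mathcal N(\mathcal Y,\mathcal E)$, with $\mathcal V=\{\mathfrak s(\exp(K+\sum_{i=1}^d\theta^iG_i)):\theta\in\mathbb R^d\}$, where $\exp$ is applied entrywise on $\mathcal E$. *)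

theory Defs
  imports "HOL-Analysis.Analysis"
begin

text \<open>
  The finite state space is the type \<open>'y::finite\<close>, and matrices indexed by it are
  elements of \<open>real ^ 'y ^ 'y\<close>, with \<open>F $ y $ y'\<close> the entry in row \<open>y\<close> and column \<open>y'\<close>.
\<close>

definition edge_set :: "('y::finite \<times> 'y) set \<Rightarrow> bool" where
  "edge_set E \<longleftrightarrow> E \<noteq> {} \<and> (\<forall>y y'. (y, y') \<in> E\<^sup>*)"

definition fun_space :: "('y::finite \<times> 'y) set \<Rightarrow> (real ^ 'y ^ 'y) set" where
  "fun_space E = {F. \<forall>y y'. (y, y') \<notin> E \<longrightarrow> F $ y $ y' = 0}"

definition pos_fun_space :: "('y::finite \<times> 'y) set \<Rightarrow> (real ^ 'y ^ 'y) set" where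
  "pos_fun_space E = {F \<in> fun_space E. \<forall>(y, y') \<in> E. F $ y $ y' > 0}"

definition stochastic_matrices :: "('y::finite \<times> 'y) set \<Rightarrow> (real ^ 'y ^ 'y) set" where
  "stochastic_matrices E = {P \<in> pos_fun_space E. \<forall>y. (\<Sum>y'\<in>UNIV. P $ y $ y') = 1}"

definition fibre :: "('y \<Rightarrow> 'x) \<Rightarrow> 'x \<Rightarrow> 'y set" where
  "fibre \<kappa> x = \<kappa> -` {x}"

definition lumped_edges :: "('y \<Rightarrow> 'x) \<Rightarrow> ('y \<times> 'y) set \<Rightarrow> ('x \<times> 'x) set" where
  "lumped_edges \<kappa> E = {(\<kappa> y, \<kappa> y') | y y'. (y, y') \<in> E}"

definition row_mass :: "real ^ 'y ^ 'y \<Rightarrow> 'y::finite \<Rightarrow> 'y set \<Rightarrow> real" where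
  "row_mass F y S = (\<Sum>y'\<in>S. F $ y $ y')"

definition lumpable_matrices ::
    "('y::finite \<Rightarrow> 'x) \<Rightarrow> ('y \<times> 'y) set \<Rightarrow> (real ^ 'y ^ 'y) set" where
  "lumpable_matrices \<kappa> E =
     {P \<in> stochastic_matrices E.
        \<forall>(x, x') \<in> lumped_edges \<kappa> E. \<forall>y1 \<in> fibre \<kappa> x. \<forall>y2 \<in> fibre \<kappa> x.
          row_mass P y1 (fibre \<kappa> x') = row_mass P y2 (fibre \<kappa> x')}"

definition complex_eigenvalues :: "real ^ 'y ^ 'y \<Rightarrow> complex set" where
  "complex_eigenvalues F =
     {\<mu>. \<exists>w :: complex ^ 'y. w \<noteq> 0 \<and> map_matrix complex_of_real F *v w = \<mu> *s w}"

text \<open>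
  The Perron--Frobenius root is the spectral radius.  The set of eigenvalues is finite and
  nonempty, so the supremum is a maximum.
\<close>

definition pf_root :: "real ^ 'y ^ 'y \<Rightarrow> real" where
  "pf_root F = Sup (cmod ` complex_eigenvalues F)"

text \<open>
  For \<open>F\<close> positive on an edge set (hence irreducible), the positive eigenvector exists and is
  unique up to a positive factor; the choice of that factor does not affect
  \<open>stochastic_rescaling\<close> below.
\<close>

definition pf_vector :: "real ^ 'y ^ 'y \<Rightarrow> real ^ 'y" where
  "pf_vector F = (SOME v. (\<forall>y. v $ y > 0) \<and> F *v v = pf_root F *s v)"

definition stochastic_rescaling :: "real ^ 'y ^ 'y \<Rightarrow> real ^ 'y ^ 'y" where
  "stochastic_rescaling F =
     (\<chi> y y'. F $ y $ y' * pf_vector F $ y' / (pf_root F * pf_vector F $ y))"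

definition null_functions :: "('y::finite \<times> 'y) set \<Rightarrow> (real ^ 'y ^ 'y) set" where
  "null_functions E =
     {N \<in> fun_space E. \<exists>(f :: 'y \<Rightarrow> real) (c :: real). \<forall>(y, y') \<in> E. N $ y $ y' = f y' - f y + c}"

text \<open>Linear independence, in the quotient by the subspace \<open>S\<close>, of the family \<open>G 1, \<dots>, G d\<close>.\<close>

definition independent_modulo ::
    "'v::real_vector set \<Rightarrow> nat \<Rightarrow> (nat \<Rightarrow> 'v) \<Rightarrow> bool" where
  "independent_modulo S d G \<longleftrightarrow>
     (\<forall>a :: nat \<Rightarrow> real. (\<Sum>i=1..d. a i *\<^sub>R G i) \<in> S \<longrightarrow> (\<forall>i\<in>{1..d}. a i = 0))"

definition exp_on :: "('y::finite \<times> 'y) set \<Rightarrow> real ^ 'y ^ 'y \<Rightarrow> real ^ 'y ^ 'y" where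
  "exp_on E F = (\<chi> y y'. if (y, y') \<in> E then exp (F $ y $ y') else 0)"

text \<open>
  A parameter in \<open>\<real>\<^sup>d\<close> is a function on \<open>nat\<close> of which only the values at \<open>1, \<dots>, d\<close> are used.
\<close>

definition e_family_of_dim ::
    "('y::finite \<times> 'y) set \<Rightarrow> nat \<Rightarrow> (real ^ 'y ^ 'y) set \<Rightarrow> bool" where
  "e_family_of_dim E d V \<longleftrightarrow>
     V \<subseteq> stochastic_matrices E \<and>
     (\<exists>K \<in> fun_space E. \<exists>G :: nat \<Rightarrow> real ^ 'y ^ 'y.
        (\<forall>i\<in>{1..d}. G i \<in> fun_space E) \<and>
        independent_modulo (null_functions E) d G \<and>
        V = {stochastic_rescaling (exp_on E (K + (\<Sum>i=1..d. \<theta> i *\<^sub>R G i))) | \<theta> :: nat \<Rightarrow> real. True})"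

definition forms_e_family :: "('y::finite \<times> 'y) set \<Rightarrow> (real ^ 'y ^ 'y) set \<Rightarrow> bool" where
  "forms_e_family E V \<longleftrightarrow> (\<exists>d. e_family_of_dim E d V)"

end

theory Submission
  imports Defs
begin

text \<open>
  Write \<open>R\<close> for \<open>stochastic_rescaling\<close>.  A nonempty set \<open>V\<close> of stochastic matrices on \<open>E\<close> is an
  e-family exactly when the set of all \<open>X\<close> with \<open>R (exp X) \<in> V\<close> is affine
  (\<open>affine_e_coordinates_if_e_family\<close>, \<open>e_family_if_affine_e_coordinates\<close>).  The reason is that
  \<open>R (exp X)\<close> determines \<open>X\<close> precisely up to the null functions
  (\<open>rescaling_eq_iff_diff_null\<close>).  So it has to be shown that for lumpable \<open>P0\<close>, \<open>P1\<close> on \<open>E\<close> and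
  \<open>s + t = 1\<close> the rescaling of the entrywise product \<open>P0\<^sup>s P1\<^sup>t\<close> is again lumpable.

  This follows by approximation from the larger edge set (\<open>lumpable_geodesic\<close>).  Fix a lumpable
  \<open>Q\<close> on \<open>E'\<close>.  Equality of row masses is a linear condition, so \<open>(1 - \<epsilon>) P0 + \<epsilon> Q\<close> and
  \<open>(1 - \<epsilon>) P1 + \<epsilon> Q\<close> are lumpable on \<open>E'\<close>, and by hypothesis so is the rescaling of their product
  with exponents \<open>s\<close> and \<open>t\<close>.  On \<open>E' - E\<close> both mixtures equal \<open>\<epsilon> Q\<close>, hence so does the product,
  even when an exponent is negative: it tends to zero there, while on \<open>E\<close> it tends to
  \<open>P0\<^sup>s P1\<^sup>t\<close>.  The limit is irreducible, so \<open>R\<close> is continuous there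
  (\<open>stochastic_rescaling_limit\<close>), and equality of row masses passes to the limit.
\<close>

section \<open>Perron--Frobenius eigenpairs\<close>

lemma pos_fun_space_nonneg:
  assumes "F \<in> pos_fun_space E"
  shows "0 \<le> F $ a $ b"
  using assms by (cases "(a, b) \<in> E") (auto simp: pos_fun_space_def fun_space_def less_imp_le)

lemma edge_into_every_vertex:
  assumes "edge_set E"
  obtains y where "(y, z) \<in> E"
proof -
  obtain a b where ab: "(a, b) \<in> E"
    using assms by (auto simp: edge_set_def)
  have "(b, z) \<in> E\<^sup>*"
    using assms by (simp add: edge_set_def)
  then show thesis
    by (cases rule: rtranclE) (use ab that in blast)+
qed

text \<open>
  Positivity travels backwards along edges: if \<open>(a, b)\<close> is an edge and \<open>v $ b > 0\<close>, then the
  eigenvalue equation at \<open>a\<close> has a positive term, so both \<open>\<rho>\<close> and \<open>v $ a\<close> are positive.  Strong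
  connectedness does the rest.
\<close>

lemma nonnegative_eigenvector_is_positive:
  fixes F :: "real ^ 'y::finite ^ 'y"
  assumes E: "edge_set E" and F: "F \<in> pos_fun_space E"
    and nonneg: "\<And>y. 0 \<le> v $ y" and nonzero: "v \<noteq> 0"
    and eigen: "F *v v = \<rho> *s v"
  shows "0 < v $ y" and "0 < \<rho>"
proof -
  note F_nonneg = pos_fun_space_nonneg[OF F]
  have step: "0 < v $ a \<and> 0 < \<rho>" if ab: "(a, b) \<in> E" and b: "0 < v $ b" for a b
  proof -
    have "0 < F $ a $ b * v $ b"
      using F ab b by (auto simp: pos_fun_space_def)
    also have "\<dots> \<le> (\<Sum>z\<in>UNIV. F $ a $ z * v $ z)"
      by (rule member_le_sum) (auto simp: F_nonneg nonneg)
    also have "\<dots> = \<rho> * v $ a"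
      using arg_cong[OF eigen, of "\<lambda>w. w $ a"] by (simp add: matrix_vector_mult_def)
    finally show ?thesis
      using nonneg[of a] by (auto simp: zero_less_mult_iff)
  qed
  obtain z where "v $ z \<noteq> 0"
    using nonzero by (auto simp: vec_eq_iff)
  then have z: "0 < v $ z"
    using nonneg[of z] by simp
  have pos: "0 < v $ a" for a
  proof -
    have "(a, z) \<in> E\<^sup>*"
      using E by (simp add: edge_set_def)
    then show ?thesis
      by (induction rule: converse_rtrancl_induct) (use z step in auto)
  qed
  then show "0 < v $ y" .
  show "0 < \<rho>"
    using edge_into_every_vertex[OF E, of z] step z by metis
qed

definition prob_simplex :: "(real ^ 'y::finite) set" where
  "prob_simplex = {v. (\<forall>y. 0 \<le> v $ y) \<and> (\<Sum>y\<in>UNIV. v $ y) = 1}"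

lemma compact_prob_simplex: "compact (prob_simplex :: (real ^ 'y::finite) set)"
proof -
  have "closed (prob_simplex :: (real ^ 'y) set)"
    unfolding prob_simplex_def
    by (intro closed_Collect_conj closed_Collect_all closed_Collect_le closed_Collect_eq
        continuous_intros)
  moreover have "bounded (prob_simplex :: (real ^ 'y) set)"
  proof (rule boundedI)
    fix v :: "real ^ 'y" assume "v \<in> prob_simplex"
    then show "norm v \<le> 1"
      using norm_le_l1_cart[of v] by (simp add: prob_simplex_def)
  qed
  ultimately show ?thesis
    by (simp add: compact_eq_bounded_closed)
qed

lemma convex_prob_simplex: "convex (prob_simplex :: (real ^ 'y::finite) set)"
  unfolding convex_def prob_simplex_def
  by (auto simp: sum.distrib simp flip: sum_distrib_left)

lemma prob_simplex_nonempty: "(prob_simplex :: (real ^ 'y::finite) set) \<noteq> {}"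
proof -
  have "(\<chi> y. 1 / real CARD('y)) \<in> (prob_simplex :: (real ^ 'y) set)"
    by (simp add: prob_simplex_def)
  then show ?thesis by blast
qed

text \<open>
  Existence comes from Brouwer's theorem for the normalised map \<open>v \<mapsto> v + F v\<close> on the simplex.
  The summand \<open>v\<close> keeps the normalising factor at least one; a fixed point is an eigenvector
  of \<open>F\<close> for that factor minus one.
\<close>

lemma perron_frobenius_eigenvector:
  fixes F :: "real ^ 'y::finite ^ 'y"
  assumes E: "edge_set E" and F: "F \<in> pos_fun_space E"
  obtains v \<rho> where "v \<in> prob_simplex" "\<And>y. 0 < v $ y" "0 < \<rho>" "F *v v = \<rho> *s v"
proof -
  let ?s = "\<lambda>v :: real ^ 'y. \<Sum>y\<in>UNIV. (v + F *v v) $ y"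
  let ?g = "\<lambda>v. (1 / ?s v) *\<^sub>R (v + F *v v)"
  note F_nonneg = pos_fun_space_nonneg[OF F]
  have Fv_nonneg: "0 \<le> (F *v v) $ y" if "v \<in> prob_simplex" for v y
    using that F_nonneg by (auto simp: matrix_vector_mult_def prob_simplex_def intro!: sum_nonneg)
  have s_ge: "1 \<le> ?s v" if "v \<in> prob_simplex" for v
  proof -
    have "0 \<le> (\<Sum>y\<in>UNIV. (F *v v) $ y)"
      by (rule sum_nonneg) (use Fv_nonneg[OF that] in auto)
    then show ?thesis
      using that by (simp add: sum.distrib prob_simplex_def)
  qed
  have cont: "continuous_on prob_simplex ?g"
    unfolding matrix_vector_mult_def
  proof (intro continuous_intros ballI)
    fix v :: "real ^ 'y" assume "v \<in> prob_simplex"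
    then show "(\<Sum>y\<in>UNIV. (v + (\<chi> i. \<Sum>j\<in>UNIV. F $ i $ j * v $ j)) $ y) \<noteq> 0"
      using s_ge[of v] by (simp add: matrix_vector_mult_def)
  qed
  have maps: "?g v \<in> prob_simplex" if v: "v \<in> prob_simplex" for v
  proof -
    have "0 \<le> ?g v $ y" for y
      using v s_ge[OF v] Fv_nonneg[OF v, of y] by (auto simp: prob_simplex_def)
    moreover have "(\<Sum>y\<in>UNIV. ?g v $ y) = 1"
      using s_ge[OF v] by (simp flip: sum_divide_distrib)
    ultimately show ?thesis
      unfolding prob_simplex_def by blast
  qed
  obtain v where v: "v \<in> prob_simplex" and fix_v: "?g v = v"
    using brouwer[OF compact_prob_simplex convex_prob_simplex prob_simplex_nonempty cont] maps
    by (metis (no_types, lifting) Pi_I)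
  have "v + F *v v = ?s v *\<^sub>R ?g v"
    using s_ge[OF v] by simp
  then have "v + F *v v = ?s v *\<^sub>R v"
    unfolding fix_v .
  moreover have "b = (c - 1) *s a" if "a + b = c *\<^sub>R a" for a b :: "real ^ 'y" and c
    using that by (simp add: scalar_mult_eq_scaleR scaleR_diff_left eq_diff_eq add.commute)
  ultimately have eigen: "F *v v = (?s v - 1) *s v"
    by blast
  have nonneg: "\<And>y. 0 \<le> v $ y" and nonzero: "v \<noteq> 0"
    using v by (auto simp: prob_simplex_def)
  show thesis
    using that[OF v _ _ eigen] nonnegative_eigenvector_is_positive[OF E F nonneg nonzero eigen]
    by blast
qed

text \<open>
  Any eigenvalue with a positive eigenvector \<open>v\<close> is the spectral radius: bounding a complex
  eigenvector \<open>w\<close> by the least multiple of \<open>v\<close> with \<open>\<bar>w\<bar> \<le> q v\<close> bounds its eigenvalue.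
\<close>

lemma pf_root_eq:
  fixes F :: "real ^ 'y::finite ^ 'y"
  assumes F: "F \<in> pos_fun_space E" and pos: "\<And>y. 0 < v $ y" and \<rho>: "0 < \<rho>"
    and eigen: "F *v v = \<rho> *s v"
  shows "pf_root F = \<rho>"
proof -
  note F_nonneg = pos_fun_space_nonneg[OF F]
  have eigen_at: "(\<Sum>z\<in>UNIV. F $ y $ z * v $ z) = \<rho> * v $ y" for y
    using arg_cong[OF eigen, of "\<lambda>w. w $ y"] by (simp add: matrix_vector_mult_def)
  have upper: "cmod \<mu> \<le> \<rho>" if "\<mu> \<in> complex_eigenvalues F" for \<mu>
  proof -
    obtain w :: "complex ^ 'y" where w0: "w \<noteq> 0"
      and w: "map_matrix complex_of_real F *v w = \<mu> *s w"
      using \<open>\<mu> \<in> complex_eigenvalues F\<close> by (auto simp: complex_eigenvalues_def)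
    define q where "q y = cmod (w $ y) / v $ y" for y
    \<comment> \<open>At a row \<open>m\<close> where \<open>\<bar>w\<bar> / v\<close> is maximal the bound \<open>\<bar>w\<bar> \<le> q v\<close> is attained.\<close>
    obtain m where m: "\<And>y. q y \<le> q m"
      using ex_is_arg_min_if_finite[of "UNIV :: 'y set" "\<lambda>y. - q y"]
      by (auto simp: is_arg_min_linorder)
    have bound: "cmod (w $ y) \<le> q m * v $ y" for y
      using m[of y] pos[of y] by (simp add: q_def pos_divide_le_eq)
    have at_m: "cmod (w $ m) = q m * v $ m"
      using pos[of m] by (simp add: q_def)
    obtain z where "w $ z \<noteq> 0"
      using w0 by (auto simp: vec_eq_iff)
    then have "0 < q z"
      using pos by (simp add: q_def)
    then have qm: "0 < q m"
      using m[of z] by simp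
    have "cmod \<mu> * (q m * v $ m) = cmod (\<Sum>z\<in>UNIV. complex_of_real (F $ m $ z) * w $ z)"
      using arg_cong[OF w, of "\<lambda>u. u $ m"]
      by (simp add: matrix_vector_mult_def map_matrix_def norm_mult flip: at_m)
    also have "\<dots> \<le> (\<Sum>z\<in>UNIV. F $ m $ z * (q m * v $ z))"
      by (rule sum_norm_le) (simp add: norm_mult F_nonneg mult_left_mono bound)
    also have "\<dots> = \<rho> * (q m * v $ m)"
      using eigen_at[of m] by (simp add: algebra_simps flip: sum_distrib_left)
    finally show ?thesis
      using qm pos[of m] by simp
  qed
  have "map_matrix complex_of_real F *v (\<chi> y. complex_of_real (v $ y))
      = complex_of_real \<rho> *s (\<chi> y. complex_of_real (v $ y))"
    by (simp add: vec_eq_iff matrix_vector_mult_def map_matrix_def eigen_at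
        flip: of_real_mult of_real_sum)
  moreover have "(\<chi> y. complex_of_real (v $ y)) \<noteq> 0"
    using pos by (auto simp: vec_eq_iff less_le)
  ultimately have "complex_of_real \<rho> \<in> complex_eigenvalues F"
    unfolding complex_eigenvalues_def by blast
  then have "\<rho> \<in> cmod ` complex_eigenvalues F"
    using \<rho> by (force intro: image_eqI[where x = "complex_of_real \<rho>"])
  then show ?thesis
    unfolding pf_root_def by (rule cSup_eq_maximum) (use upper in auto)
qed

text \<open>
  Subtract from \<open>u\<close> the largest multiple of \<open>v\<close> that leaves a nonnegative vector.  The difference
  is an eigenvector with a zero entry, so it vanishes by
  \<open>nonnegative_eigenvector_is_positive\<close>.
\<close>

lemma positive_eigenvectors_proportional:
  fixes F :: "real ^ 'y::finite ^ 'y"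
  assumes E: "edge_set E" and F: "F \<in> pos_fun_space E"
    and u: "\<And>y. 0 < u $ y" "F *v u = \<rho> *s u"
    and v: "\<And>y. 0 < v $ y" "F *v v = \<rho> *s v"
  obtains c where "0 < c" "u = c *s v"
proof -
  obtain m where m: "\<And>y. u $ m / v $ m \<le> u $ y / v $ y"
    using ex_is_arg_min_if_finite[of "UNIV :: 'y set" "\<lambda>y. u $ y / v $ y"]
    by (auto simp: is_arg_min_linorder)
  define c where "c = u $ m / v $ m"
  let ?w = "u - c *s v"
  have nonneg: "0 \<le> ?w $ y" for y
    using m[of y] v(1)[of y] by (simp add: c_def pos_le_divide_eq)
  have "?w $ m = 0"
    using v(1)[of m] by (simp add: c_def)
  moreover have "F *v ?w = \<rho> *s ?w"
    using u(2) v(2) by (simp add: scalar_mult_eq_scaleR matrix_vector_mult_diff_distrib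
        matrix_vector_mult_scaleR algebra_simps)
  ultimately have "?w = 0"
    using nonnegative_eigenvector_is_positive(1)[OF E F nonneg] by (metis less_irrefl)
  moreover have "0 < c"
    using u(1) v(1) by (simp add: c_def)
  ultimately show thesis
    using that by simp
qed

text \<open>
  This frees all later arguments from the spectral radius and from the choice made in
  \<open>pf_vector\<close>: any positive eigenpair computes the rescaling.
\<close>

lemma stochastic_rescaling_eq:
  fixes F :: "real ^ 'y::finite ^ 'y"
  assumes E: "edge_set E" and F: "F \<in> pos_fun_space E"
    and v: "\<And>y. 0 < v $ y" and \<rho>: "0 < \<rho>" and eigen: "F *v v = \<rho> *s v"
  shows "stochastic_rescaling F = (\<chi> y y'. F $ y $ y' * v $ y' / (\<rho> * v $ y))"
proof -
  have root: "pf_root F = \<rho>"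
    using pf_root_eq[OF F v \<rho> eigen] .
  have "(\<forall>y. pf_vector F $ y > 0) \<and> F *v pf_vector F = pf_root F *s pf_vector F"
    unfolding pf_vector_def by (rule someI[where x = v]) (simp add: root v eigen)
  then obtain c where "0 < c" "pf_vector F = c *s v"
    using positive_eigenvectors_proportional[OF E F _ _ v eigen] by (metis root)
  then show ?thesis
    by (simp add: stochastic_rescaling_def root vec_eq_iff)
qed

lemma stochastic_rescaling_in_stochastic_matrices:
  fixes F :: "real ^ 'y::finite ^ 'y"
  assumes E: "edge_set E" and F: "F \<in> pos_fun_space E"
  shows "stochastic_rescaling F \<in> stochastic_matrices E"
proof -
  obtain v \<rho> where v: "\<And>y. 0 < v $ y" and \<rho>: "0 < \<rho>" and eigen: "F *v v = \<rho> *s v"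
    using perron_frobenius_eigenvector[OF E F] by blast
  have "(\<Sum>z\<in>UNIV. F $ y $ z * v $ z) = \<rho> * v $ y" for y
    using arg_cong[OF eigen, of "\<lambda>w. w $ y"] by (simp add: matrix_vector_mult_def)
  then have "(\<Sum>z\<in>UNIV. F $ y $ z * v $ z / (\<rho> * v $ y)) = 1" for y
    using \<rho> v[of y] by (simp flip: sum_divide_distrib)
  then show ?thesis
    using F v \<rho> by (auto simp: stochastic_rescaling_eq[OF E F v \<rho> eigen] stochastic_matrices_def
        pos_fun_space_def fun_space_def)
qed

lemma stochastic_rescaling_of_stochastic:
  assumes E: "edge_set E" and P: "P \<in> stochastic_matrices E"
  shows "stochastic_rescaling P = P"
proof -
  have "P \<in> pos_fun_space E" and "P *v (\<chi> y. 1) = 1 *s (\<chi> y. 1)"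
    using P by (auto simp: stochastic_matrices_def matrix_vector_mult_def vec_eq_iff)
  from stochastic_rescaling_eq[OF E this(1) _ _ this(2)] show ?thesis
    by (simp add: vec_eq_iff)
qed

text \<open>
  Continuity of the rescaling when edges may vanish in the limit.  The normalised eigenvectors
  have a convergent subsequence by compactness, and its limit is a nonnegative eigenvector of
  \<open>L\<close>.  Irreducibility of \<open>L\<close> makes it positive, so \<open>stochastic_rescaling_eq\<close> applies on both
  sides of the limit.  Convergence along a subsequence suffices for passing closed conditions to
  the limit.
\<close>

lemma stochastic_rescaling_limit:
  fixes F :: "nat \<Rightarrow> real ^ 'y::finite ^ 'y"
  assumes E': "edge_set E'" and F: "\<And>n. F n \<in> pos_fun_space E'"
    and E: "edge_set E" and L: "L \<in> pos_fun_space E"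
    and lim: "F \<longlonglongrightarrow> L"
  obtains r where "strict_mono r" "(\<lambda>n. stochastic_rescaling (F (r n))) \<longlonglongrightarrow> stochastic_rescaling L"
proof -
  have "\<exists>v \<rho>. v \<in> prob_simplex \<and> (\<forall>y. 0 < v $ y) \<and> 0 < \<rho> \<and> F n *v v = \<rho> *s v" for n
    using perron_frobenius_eigenvector[OF E' F[of n]] by metis
  then obtain v \<rho> where v: "\<And>n. v n \<in> prob_simplex" "\<And>n y. 0 < v n $ y"
    and \<rho>: "\<And>n. 0 < \<rho> n" and eigen: "\<And>n. F n *v v n = \<rho> n *s v n"
    by metis
  obtain w r where w: "w \<in> prob_simplex" and r: "strict_mono r" and v_lim: "(v \<circ> r) \<longlonglongrightarrow> w"
    using compact_prob_simplex v(1) unfolding compact_def by metis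
  have F_lim: "(\<lambda>n. F (r n)) \<longlonglongrightarrow> L"
    using LIMSEQ_subseq_LIMSEQ[OF lim r] by (simp add: o_def)
  have v_at: "(\<lambda>n. v (r n) $ y) \<longlonglongrightarrow> w $ y" for y
    using tendsto_vec_nth[OF v_lim, of y] by (simp add: o_def)
  have F_at: "(\<lambda>n. F (r n) $ y $ z) \<longlonglongrightarrow> L $ y $ z" for y z
    by (intro tendsto_vec_nth F_lim)
  \<comment> \<open>The entries of \<open>v n\<close> sum to one, so those of \<open>F n *v v n\<close> sum to \<open>\<rho> n\<close>.\<close>
  define \<sigma> where "\<sigma> = (\<Sum>y\<in>UNIV. (L *v w) $ y)"
  have Fv_lim: "(\<lambda>n. (F (r n) *v v (r n)) $ y) \<longlonglongrightarrow> (L *v w) $ y" for y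
    by (simp add: matrix_vector_mult_def) (intro tendsto_intros F_at v_at)
  have "\<rho> n = (\<Sum>y\<in>UNIV. (F n *v v n) $ y)" for n
    using v(1)[of n] by (simp add: eigen prob_simplex_def flip: sum_distrib_left)
  then have \<rho>_lim: "(\<lambda>n. \<rho> (r n)) \<longlonglongrightarrow> \<sigma>"
    unfolding \<sigma>_def by (simp only:) (intro tendsto_intros Fv_lim)
  have "(L *v w) $ y = \<sigma> * w $ y" for y
  proof (rule LIMSEQ_unique[OF Fv_lim])
    show "(\<lambda>n. (F (r n) *v v (r n)) $ y) \<longlonglongrightarrow> \<sigma> * w $ y"
      unfolding eigen by simp (intro tendsto_intros \<rho>_lim v_at)
  qed
  then have w_eigen: "L *v w = \<sigma> *s w"
    by (simp add: vec_eq_iff)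
  have "\<And>y. 0 \<le> w $ y" and "w \<noteq> 0"
    using w by (auto simp: prob_simplex_def)
  note w_pos = nonnegative_eigenvector_is_positive[OF E L this w_eigen]
  have "(\<lambda>n. stochastic_rescaling (F (r n))) \<longlonglongrightarrow> stochastic_rescaling L"
    unfolding stochastic_rescaling_eq[OF E L w_pos w_eigen]
      stochastic_rescaling_eq[OF E' F v(2) \<rho> eigen]
    using w_pos by (intro tendsto_vec_lambda tendsto_intros F_at v_at \<rho>_lim) (simp add: less_le)
  then show thesis
    using that r by blast
qed

section \<open>Equality of rescalings in logarithmic coordinates\<close>

definition ln_on :: "('y::finite \<times> 'y) set \<Rightarrow> real ^ 'y ^ 'y \<Rightarrow> real ^ 'y ^ 'y" where
  "ln_on E F = (\<chi> y y'. if (y, y') \<in> E then ln (F $ y $ y') else 0)"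

lemma ln_on_in_fun_space: "ln_on E F \<in> fun_space E"
  by (simp add: ln_on_def fun_space_def)

lemma exp_on_in_pos_fun_space: "exp_on E X \<in> pos_fun_space E"
  by (auto simp: exp_on_def pos_fun_space_def fun_space_def)

lemma exp_on_ln_on: "P \<in> pos_fun_space E \<Longrightarrow> exp_on E (ln_on E P) = P"
  by (auto simp: exp_on_def ln_on_def pos_fun_space_def fun_space_def vec_eq_iff)

lemma subspace_fun_space: "subspace (fun_space E)"
  by (auto simp: subspace_def fun_space_def)

lemma subspace_null_functions: "subspace (null_functions E)"
proof (rule subspaceI)
  show "0 \<in> null_functions E"
    unfolding null_functions_def fun_space_def
    by (auto intro!: exI[where x = "\<lambda>_. 0"] exI[where x = 0])
next
  fix M N assume "M \<in> null_functions E" and "N \<in> null_functions E"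
  then obtain f g c d where
    M: "M \<in> fun_space E" "\<forall>(y, y') \<in> E. M $ y $ y' = f y' - f y + c" and
    N: "N \<in> fun_space E" "\<forall>(y, y') \<in> E. N $ y $ y' = g y' - g y + d"
    by (auto simp: null_functions_def)
  have "\<forall>(y, y') \<in> E. (M + N) $ y $ y' = (f y' + g y') - (f y + g y) + (c + d)"
    using M(2) N(2) by fastforce
  then show "M + N \<in> null_functions E"
    unfolding null_functions_def using subspace_add[OF subspace_fun_space M(1) N(1)]
    by (auto intro!: exI[where x = "\<lambda>y. f y + g y"] exI[where x = "c + d"])
next
  fix a :: real and N assume "N \<in> null_functions E"
  then obtain g d where
    N: "N \<in> fun_space E" "\<forall>(y, y') \<in> E. N $ y $ y' = g y' - g y + d"
    by (auto simp: null_functions_def)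
  have "(a *\<^sub>R N) $ y $ y' = a * g y' - a * g y + a * d" if "(y, y') \<in> E" for y y'
  proof -
    have "N $ y $ y' = g y' - g y + d"
      using N(2) that by blast
    then have "a * N $ y $ y' = a * (g y' - g y + d)"
      by simp
    then show ?thesis
      by (simp add: algebra_simps)
  qed
  then show "a *\<^sub>R N \<in> null_functions E"
    unfolding null_functions_def using subspace_scale[OF subspace_fun_space N(1), of a]
    by (auto intro!: exI[where x = "\<lambda>y. a * g y"] exI[where x = "a * d"])
qed

text \<open>
  Conjugating a matrix by a positive diagonal matrix and scaling it does not change its rescaling,
  and in logarithmic coordinates this is the addition of \<open>f y' - f y + c\<close>.  Conversely, if two
  rescalings agree, taking logarithms of the two formulas exhibits the difference in this form,
  with \<open>f\<close> the log-ratio of the eigenvectors and \<open>c\<close> that of the eigenvalues.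
\<close>

lemma rescaling_eq_iff_diff_null:
  assumes E: "edge_set E" and X: "X \<in> fun_space E" and Y: "Y \<in> fun_space E"
  shows "stochastic_rescaling (exp_on E X) = stochastic_rescaling (exp_on E Y)
    \<longleftrightarrow> X - Y \<in> null_functions E"
proof
  note rescaling = stochastic_rescaling_eq[OF E exp_on_in_pos_fun_space]
  obtain v \<sigma> where v: "\<And>y. 0 < v $ y" "0 < \<sigma>" "exp_on E Y *v v = \<sigma> *s v"
    using perron_frobenius_eigenvector[OF E exp_on_in_pos_fun_space] by metis
  {
    assume eq: "stochastic_rescaling (exp_on E X) = stochastic_rescaling (exp_on E Y)"
    obtain u \<rho> where u: "\<And>y. 0 < u $ y" "0 < \<rho>" "exp_on E X *v u = \<rho> *s u"
      using perron_frobenius_eigenvector[OF E exp_on_in_pos_fun_space] by metis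
    define f where "f y = ln (v $ y) - ln (u $ y)" for y
    have "(X - Y) $ y $ y' = f y' - f y + (ln \<rho> - ln \<sigma>)" if "(y, y') \<in> E" for y y'
    proof -
      have "exp (X $ y $ y') * u $ y' / (\<rho> * u $ y) = exp (Y $ y $ y') * v $ y' / (\<sigma> * v $ y)"
        using arg_cong[OF eq[unfolded rescaling[OF u] rescaling[OF v]], of "\<lambda>M. M $ y $ y'"] that
        by (simp add: exp_on_def)
      then have "ln (exp (X $ y $ y') * u $ y' / (\<rho> * u $ y))
          = ln (exp (Y $ y $ y') * v $ y' / (\<sigma> * v $ y))"
        by simp
      then show ?thesis
        using u(1)[of y] u(1)[of y'] v(1)[of y] v(1)[of y'] u(2) v(2)
        by (simp add: f_def ln_mult ln_div)
    qed
    then show "X - Y \<in> null_functions E"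
      unfolding null_functions_def using subspace_diff[OF subspace_fun_space X Y] by blast
  }
  {
    assume "X - Y \<in> null_functions E"
    then obtain f c where "\<forall>(y, y') \<in> E. (X - Y) $ y $ y' = f y' - f y + c"
      by (auto simp: null_functions_def)
    then have XY: "X $ y $ y' = Y $ y $ y' + (f y' - f y + c)" if "(y, y') \<in> E" for y y'
      using that by fastforce
    \<comment> \<open>The conjugation turns the eigenvector \<open>v\<close> into \<open>exp (- f) v\<close>.\<close>
    define u :: "real ^ _" where "u = (\<chi> y. exp (- f y) * v $ y)"
    have twist: "exp_on E X $ y $ z * u $ z = exp (c - f y) * (exp_on E Y $ y $ z * v $ z)" for y z
      by (simp add: exp_on_def u_def XY exp_add exp_diff exp_minus field_simps)
    have "(\<Sum>z\<in>UNIV. exp_on E Y $ y $ z * v $ z) = \<sigma> * v $ y" for y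
      using arg_cong[OF v(3), of "\<lambda>w. w $ y"] by (simp add: matrix_vector_mult_def)
    then have "(exp_on E X *v u) $ y = exp (c - f y) * (\<sigma> * v $ y)" for y
      by (simp add: matrix_vector_mult_def twist flip: sum_distrib_left)
    then have "exp_on E X *v u = (exp c * \<sigma>) *s u"
      by (simp add: vec_eq_iff u_def exp_diff exp_minus field_simps)
    moreover have "\<And>y. 0 < u $ y"
      using v(1) by (simp add: u_def)
    moreover have "0 < exp c * \<sigma>"
      using v(2) by simp
    ultimately show "stochastic_rescaling (exp_on E X) = stochastic_rescaling (exp_on E Y)"
      by (simp add: rescaling[OF v] rescaling[of u "exp c * \<sigma>"] vec_eq_iff twist)
        (simp add: u_def exp_diff exp_minus field_simps)
  }
qed

section \<open>An e-family is an affine space of logarithmic coordinates\<close>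

text \<open>
  All matrices on \<open>E\<close> whose exponential rescales into \<open>V\<close>, so that the set is a union of cosets of
  the null functions and no representatives have to be chosen.
\<close>

definition e_coordinates ::
    "('y::finite \<times> 'y) set \<Rightarrow> (real ^ 'y ^ 'y) set \<Rightarrow> (real ^ 'y ^ 'y) set" where
  "e_coordinates E V = {X \<in> fun_space E. stochastic_rescaling (exp_on E X) \<in> V}"

lemma ln_on_in_e_coordinates:
  assumes "edge_set E" "P \<in> stochastic_matrices E" "P \<in> V"
  shows "ln_on E P \<in> e_coordinates E V"
proof -
  have "P \<in> pos_fun_space E"
    using assms(2) by (simp add: stochastic_matrices_def)
  then show ?thesis
    using assms by (simp add: e_coordinates_def ln_on_in_fun_space exp_on_ln_on
        stochastic_rescaling_of_stochastic)
qed

lemma e_coordinates_add_null: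
  assumes E: "edge_set E" and X: "X \<in> e_coordinates E V" and N: "N \<in> null_functions E"
  shows "X + N \<in> e_coordinates E V"
proof -
  have X': "X \<in> fun_space E" and N': "N \<in> fun_space E"
    using X N by (auto simp: e_coordinates_def null_functions_def)
  then have XN: "X + N \<in> fun_space E"
    by (rule subspace_add[OF subspace_fun_space])
  then have "stochastic_rescaling (exp_on E (X + N)) = stochastic_rescaling (exp_on E X)"
    using rescaling_eq_iff_diff_null[OF E XN X'] N by simp
  then show ?thesis
    using X XN by (simp add: e_coordinates_def)
qed

text \<open>
  By \<open>rescaling_eq_iff_diff_null\<close> the coordinates of the e-family are
  \<open>K + span {G 1, \<dots>, G d} + null_functions E\<close>.
\<close>

lemma affine_e_coordinates_if_e_family:
  assumes E: "edge_set E" and "forms_e_family E V"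
  shows "affine (e_coordinates E V)"
proof -
  obtain d K G where K: "K \<in> fun_space E" and G: "\<forall>i\<in>{1..d}. G i \<in> fun_space E"
    and V: "V = {stochastic_rescaling (exp_on E (K + (\<Sum>i=1..d. \<theta> i *\<^sub>R G i))) | \<theta> :: nat \<Rightarrow> real. True}"
    using assms(2) by (auto simp: forms_e_family_def e_family_of_dim_def)
  define p where "p \<theta> = K + (\<Sum>i=1..d. \<theta> i *\<^sub>R G i)" for \<theta> :: "nat \<Rightarrow> real"
  have p: "p \<theta> \<in> fun_space E" for \<theta>
    unfolding p_def
    using G by (intro subspace_add[OF subspace_fun_space K] subspace_sum subspace_scale
        subspace_fun_space) auto
  have V': "V = range (\<lambda>\<theta>. stochastic_rescaling (exp_on E (p \<theta>)))"
    unfolding V p_def by auto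
  have coords: "X \<in> e_coordinates E V \<longleftrightarrow> X \<in> fun_space E \<and> (\<exists>\<theta>. X - p \<theta> \<in> null_functions E)" for X
    using rescaling_eq_iff_diff_null[OF E _ p] by (auto simp: e_coordinates_def V' image_iff)
  show ?thesis
    unfolding affine_def
  proof (intro ballI allI impI)
    fix X Y and s t :: real
    assume X: "X \<in> e_coordinates E V" and Y: "Y \<in> e_coordinates E V" and st: "s + t = 1"
    obtain \<theta> \<eta> where N: "X - p \<theta> \<in> null_functions E" "Y - p \<eta> \<in> null_functions E"
      using X Y coords by blast
    have "p (\<lambda>i. s * \<theta> i + t * \<eta> i) = (s + t) *\<^sub>R K + (s *\<^sub>R (\<Sum>i=1..d. \<theta> i *\<^sub>R G i)
        + t *\<^sub>R (\<Sum>i=1..d. \<eta> i *\<^sub>R G i))"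
      unfolding p_def st by (simp add: scaleR_add_left sum.distrib scaleR_sum_right)
    then have "s *\<^sub>R X + t *\<^sub>R Y - p (\<lambda>i. s * \<theta> i + t * \<eta> i) = s *\<^sub>R (X - p \<theta>) + t *\<^sub>R (Y - p \<eta>)"
      by (simp add: p_def algebra_simps)
    moreover have "s *\<^sub>R (X - p \<theta>) + t *\<^sub>R (Y - p \<eta>) \<in> null_functions E"
      using N by (intro subspace_add subspace_scale subspace_null_functions)
    moreover have "s *\<^sub>R X + t *\<^sub>R Y \<in> fun_space E"
      using X Y coords by (intro subspace_add subspace_scale subspace_fun_space) auto
    ultimately show "s *\<^sub>R X + t *\<^sub>R Y \<in> e_coordinates E V"
      using coords by metis
  qed
qed

text \<open>
  Extend a basis \<open>A\<close> of \<open>N\<close> to a basis of \<open>U\<close>; the added vectors are the required family.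
\<close>

lemma basis_modulo_subspace:
  fixes N U :: "'v::euclidean_space set"
  assumes N: "subspace N" and U: "subspace U" and NU: "N \<subseteq> U"
  obtains d G where "\<forall>i\<in>{1..d}. G i \<in> U" "independent_modulo N d G"
    "\<And>x. x \<in> U \<Longrightarrow> \<exists>\<theta>. x - (\<Sum>i=1..d. \<theta> i *\<^sub>R G i) \<in> N"
proof -
  obtain A where A: "A \<subseteq> N" "independent A" "N \<subseteq> span A"
    using basis_exists[of N] by metis
  then have spanA: "span A = N"
    using N span_minimal[of A N] by blast
  obtain B where B: "A \<subseteq> B" "B \<subseteq> U" "independent B" "U \<subseteq> span B"
    using maximal_independent_subset_extend[of A U] A NU by (metis subset_trans)
  define C where "C = B - A"
  have finB: "finite B"
    using B(3) by (rule independent_imp_finite)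
  then have fin: "finite C" "finite A"
    using B(1) by (auto simp: C_def intro: finite_subset)
  define d where "d = card C"
  obtain G where G: "bij_betw G {1..d} C"
    using ex_bij_betw_nat_finite_1[OF fin(1)] d_def by blast
  have sum_G: "(\<Sum>i=1..d. a (G i) *\<^sub>R G i) = (\<Sum>c\<in>C. a c *\<^sub>R c)" for a :: "'v \<Rightarrow> real"
    using sum.reindex_bij_betw[OF G, of "\<lambda>c. a c *\<^sub>R c"] .
  have mem: "\<forall>i\<in>{1..d}. G i \<in> U"
    using G B(2) by (auto simp: bij_betw_def C_def)
  have ind: "independent_modulo N d G"
    unfolding independent_modulo_def
  proof (intro allI impI ballI)
    fix a :: "nat \<Rightarrow> real" and i
    assume inN: "(\<Sum>i=1..d. a i *\<^sub>R G i) \<in> N" and i: "i \<in> {1..d}"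
    define b where "b = a \<circ> the_inv_into {1..d} G"
    have bG: "b (G j) = a j" if "j \<in> {1..d}" for j
      using the_inv_into_f_f[of G "{1..d}" j] G that by (simp add: b_def bij_betw_def)
    have "(\<Sum>c\<in>C. b c *\<^sub>R c) = (\<Sum>i=1..d. a i *\<^sub>R G i)"
      unfolding sum_G[symmetric] by (rule sum.cong) (simp_all add: bG)
    then have "(\<Sum>c\<in>C. b c *\<^sub>R c) \<in> span A"
      using inN by (simp only: spanA)
    then obtain e where e: "(\<Sum>c\<in>C. b c *\<^sub>R c) = (\<Sum>x\<in>A. e x *\<^sub>R x)"
      using span_finite[OF fin(2)] by auto
    \<comment> \<open>Moving everything to one side gives a linear relation on the basis \<open>B\<close>.\<close>
    define h where "h x = (if x \<in> A then - e x else b x)" for x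
    have "(\<Sum>x\<in>B. h x *\<^sub>R x) = (\<Sum>x\<in>C. h x *\<^sub>R x) + (\<Sum>x\<in>A. h x *\<^sub>R x)"
      unfolding C_def by (rule sum.subset_diff[OF B(1) finB])
    also have "(\<Sum>x\<in>C. h x *\<^sub>R x) = (\<Sum>x\<in>C. b x *\<^sub>R x)"
      by (rule sum.cong) (auto simp: h_def C_def)
    also have "(\<Sum>x\<in>A. h x *\<^sub>R x) = - (\<Sum>x\<in>A. e x *\<^sub>R x)"
      by (simp add: h_def flip: sum_negf)
    finally have "(\<Sum>x\<in>B. h x *\<^sub>R x) = 0"
      using e by simp
    moreover have "G i \<in> C"
      using G i by (auto simp: bij_betw_def)
    ultimately have "h (G i) = 0"
      using independentD[OF B(3) finB subset_refl] by (auto simp: C_def)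
    then show "a i = 0"
      using \<open>G i \<in> C\<close> bG[OF i] by (simp add: h_def C_def)
  qed
  have gen: "\<exists>\<theta>. x - (\<Sum>i=1..d. \<theta> i *\<^sub>R G i) \<in> N" if "x \<in> U" for x
  proof -
    have "x \<in> span B"
      using that B(4) by blast
    then obtain e where e: "x = (\<Sum>b\<in>B. e b *\<^sub>R b)"
      using span_finite[OF finB] by auto
    also have "\<dots> = (\<Sum>b\<in>C. e b *\<^sub>R b) + (\<Sum>b\<in>A. e b *\<^sub>R b)"
      unfolding C_def by (rule sum.subset_diff[OF B(1) finB])
    finally have "x - (\<Sum>i=1..d. e (G i) *\<^sub>R G i) = (\<Sum>b\<in>A. e b *\<^sub>R b)"
      unfolding sum_G by simp
    also have "\<dots> \<in> N"
      using A(1) by (intro subspace_sum[OF N] subspace_scale[OF N]) auto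
    finally show ?thesis
      by (rule exI[where x = "\<lambda>i. e (G i)"])
  qed
  show thesis
    using that[OF mem ind gen] by blast
qed

text \<open>
  The translate of the coordinates by one of their points is a subspace containing the null
  functions, and a basis of it modulo these generates the e-family.
\<close>

lemma e_family_if_affine_e_coordinates:
  assumes E: "edge_set E" and V: "V \<subseteq> stochastic_matrices E" "V \<noteq> {}"
    and affine: "affine (e_coordinates E V)"
  shows "forms_e_family E V"
proof -
  obtain P where "P \<in> V"
    using V(2) by blast
  define K where "K = ln_on E P"
  have K: "K \<in> e_coordinates E V"
    using ln_on_in_e_coordinates[OF E] \<open>P \<in> V\<close> V(1) by (auto simp: K_def)
  define U where "U = {X - K | X. X \<in> e_coordinates E V}"
  have U: "subspace U"
    using affine_diffs_subspace_subtract[OF affine K] by (simp add: U_def Setcompr_eq_image)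
  have "null_functions E \<subseteq> U"
  proof
    fix N assume "N \<in> null_functions E"
    then have "K + N \<in> e_coordinates E V"
      by (rule e_coordinates_add_null[OF E K])
    then show "N \<in> U"
      unfolding U_def by force
  qed
  then obtain d G where G: "\<forall>i\<in>{1..d}. G i \<in> U" "independent_modulo (null_functions E) d G"
    and gen: "\<And>x. x \<in> U \<Longrightarrow> \<exists>\<theta>. x - (\<Sum>i=1..d. \<theta> i *\<^sub>R G i) \<in> null_functions E"
    using basis_modulo_subspace[OF subspace_null_functions U] by metis
  have U_fun: "U \<subseteq> fun_space E"
    using K subspace_diff[OF subspace_fun_space] by (auto simp: U_def e_coordinates_def)
  have coords: "K + (\<Sum>i=1..d. \<theta> i *\<^sub>R G i) \<in> e_coordinates E V" for \<theta> :: "nat \<Rightarrow> real"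
  proof -
    have "(\<Sum>i=1..d. \<theta> i *\<^sub>R G i) \<in> U"
      using G(1) by (intro subspace_sum[OF U] subspace_scale[OF U]) auto
    then show ?thesis
      by (auto simp: U_def)
  qed
  have "V = {stochastic_rescaling (exp_on E (K + (\<Sum>i=1..d. \<theta> i *\<^sub>R G i))) | \<theta> :: nat \<Rightarrow> real. True}"
  proof (intro equalityI subsetI)
    fix Q assume Q: "Q \<in> V"
    then have Qs: "Q \<in> stochastic_matrices E"
      using V(1) by blast
    then have lnQ: "ln_on E Q \<in> e_coordinates E V"
      using ln_on_in_e_coordinates[OF E _ Q] by blast
    then obtain \<theta> where \<theta>: "ln_on E Q - K - (\<Sum>i=1..d. \<theta> i *\<^sub>R G i) \<in> null_functions E"
      using gen unfolding U_def by blast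
    have "ln_on E Q - (K + (\<Sum>i=1..d. \<theta> i *\<^sub>R G i)) \<in> null_functions E"
      using \<theta> by (simp add: algebra_simps)
    then have "stochastic_rescaling (exp_on E (ln_on E Q))
        = stochastic_rescaling (exp_on E (K + (\<Sum>i=1..d. \<theta> i *\<^sub>R G i)))"
      using rescaling_eq_iff_diff_null[OF E ln_on_in_fun_space] coords
      by (simp add: e_coordinates_def)
    moreover have "stochastic_rescaling (exp_on E (ln_on E Q)) = Q"
      using Qs stochastic_rescaling_of_stochastic[OF E Qs]
      by (simp add: exp_on_ln_on stochastic_matrices_def)
    ultimately show "Q \<in> {stochastic_rescaling (exp_on E (K + (\<Sum>i=1..d. \<theta> i *\<^sub>R G i))) | \<theta> :: nat \<Rightarrow> real. True}"
      by auto
  next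
    fix Q
    assume "Q \<in> {stochastic_rescaling (exp_on E (K + (\<Sum>i=1..d. \<theta> i *\<^sub>R G i))) | \<theta> :: nat \<Rightarrow> real. True}"
    then show "Q \<in> V"
      using coords by (auto simp: e_coordinates_def)
  qed
  moreover have "K \<in> fun_space E"
    by (simp add: K_def ln_on_in_fun_space)
  ultimately show ?thesis
    unfolding forms_e_family_def e_family_of_dim_def
    using V(1) G U_fun by blast
qed

section \<open>Lumpable matrices on a larger edge set approximate those on a smaller one\<close>

text \<open>
  For a pair of classes outside \<open>lumped_edges \<kappa> E\<close> all row masses are zero, so the lumpability
  condition may be stated for all pairs of classes.  In this form it no longer mentions the edge
  set, which allows it to be carried between \<open>E\<close> and \<open>E'\<close>.
\<close>

lemma lumpable_matrices_iff:
  "P \<in> lumpable_matrices \<kappa> E \<longleftrightarrow> P \<in> stochastic_matrices E \<and>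
    (\<forall>y1 y2 x'. \<kappa> y1 = \<kappa> y2 \<longrightarrow> row_mass P y1 (fibre \<kappa> x') = row_mass P y2 (fibre \<kappa> x'))"
proof -
  have zero: "row_mass P y (fibre \<kappa> x') = 0"
    if "P \<in> stochastic_matrices E" "(\<kappa> y, x') \<notin> lumped_edges \<kappa> E" for y x'
    unfolding row_mass_def using that
    by (intro sum.neutral) (auto simp: stochastic_matrices_def pos_fun_space_def fun_space_def
        fibre_def lumped_edges_def)
  have "row_mass P y1 (fibre \<kappa> x') = row_mass P y2 (fibre \<kappa> x')"
    if P: "P \<in> lumpable_matrices \<kappa> E" and eq: "\<kappa> y1 = \<kappa> y2" for y1 y2 x'
  proof (cases "(\<kappa> y1, x') \<in> lumped_edges \<kappa> E")
    case True
    then have "\<forall>u\<in>fibre \<kappa> (\<kappa> y1). \<forall>w\<in>fibre \<kappa> (\<kappa> y1).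
        row_mass P u (fibre \<kappa> x') = row_mass P w (fibre \<kappa> x')"
      using P unfolding lumpable_matrices_def by blast
    moreover have "y1 \<in> fibre \<kappa> (\<kappa> y1)" "y2 \<in> fibre \<kappa> (\<kappa> y1)"
      using eq by (simp_all add: fibre_def)
    ultimately show ?thesis
      by blast
  next
    case False
    then show ?thesis
      using P eq zero[of y1 x'] zero[of y2 x'] by (simp add: lumpable_matrices_def)
  qed
  moreover have "P \<in> lumpable_matrices \<kappa> E"
    if "P \<in> stochastic_matrices E"
      and mass: "\<And>y1 y2 x'. \<kappa> y1 = \<kappa> y2 \<Longrightarrow> row_mass P y1 (fibre \<kappa> x') = row_mass P y2 (fibre \<kappa> x')"
    unfolding lumpable_matrices_def
    using that(1) by (auto intro!: mass) (simp add: fibre_def)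
  moreover have "P \<in> stochastic_matrices E" if "P \<in> lumpable_matrices \<kappa> E"
    using that by (simp add: lumpable_matrices_def)
  ultimately show ?thesis
    by metis
qed

lemma mixture_lumpable:
  assumes sub: "E \<subseteq> E'" and P: "P \<in> lumpable_matrices \<kappa> E" and Q: "Q \<in> lumpable_matrices \<kappa> E'"
    and a: "0 \<le> a" and b: "0 < b" and ab: "a + b = 1"
  shows "a *\<^sub>R P + b *\<^sub>R Q \<in> lumpable_matrices \<kappa> E'"
proof -
  have "P \<in> pos_fun_space E"
    using P by (simp add: lumpable_matrices_def stochastic_matrices_def)
  note P_nonneg = pos_fun_space_nonneg[OF this]
  have zero: "P $ y $ z = 0" "Q $ y $ z = 0" if "(y, z) \<notin> E'" for y z
    using that sub P Q by (auto simp: lumpable_matrices_def stochastic_matrices_def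
        pos_fun_space_def fun_space_def)
  have Q_pos: "0 < Q $ y $ z" if "(y, z) \<in> E'" for y z
    using that Q by (auto simp: lumpable_matrices_def stochastic_matrices_def pos_fun_space_def)
  have "(\<Sum>z\<in>UNIV. P $ y $ z) = 1" "(\<Sum>z\<in>UNIV. Q $ y $ z) = 1" for y
    using P Q by (auto simp: lumpable_matrices_def stochastic_matrices_def)
  then have "a *\<^sub>R P + b *\<^sub>R Q \<in> stochastic_matrices E'"
    using a b ab P_nonneg zero Q_pos
    by (auto simp: stochastic_matrices_def pos_fun_space_def fun_space_def sum.distrib
        intro!: add_nonneg_pos simp flip: sum_distrib_left)
  moreover have "row_mass (a *\<^sub>R P + b *\<^sub>R Q) y S = a * row_mass P y S + b * row_mass Q y S" for y S
    by (simp add: row_mass_def sum.distrib sum_distrib_left)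
  ultimately show ?thesis
    using P Q unfolding lumpable_matrices_iff by metis
qed

text \<open>
  The limit argument: \<open>F n\<close> is the product of powers of the two mixtures with \<open>Q\<close>, whose rescaling
  is lumpable on \<open>E'\<close> because the coordinates there are affine, and \<open>F n\<close> tends to the
  corresponding product \<open>L\<close> of \<open>P0\<close> and \<open>P1\<close> on the smaller edge set.
\<close>

lemma lumpable_geodesic:
  fixes \<kappa> :: "'y::finite \<Rightarrow> 'x"
  assumes E: "edge_set E" and E': "edge_set E'" and sub: "E \<subseteq> E'"
    and Q: "Q \<in> lumpable_matrices \<kappa> E'"
    and affine: "affine (e_coordinates E' (lumpable_matrices \<kappa> E'))"
    and P: "P0 \<in> lumpable_matrices \<kappa> E" "P1 \<in> lumpable_matrices \<kappa> E" and st: "s + t = 1"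
  shows "stochastic_rescaling (exp_on E (s *\<^sub>R ln_on E P0 + t *\<^sub>R ln_on E P1)) \<in> lumpable_matrices \<kappa> E"
proof -
  define L where "L = exp_on E (s *\<^sub>R ln_on E P0 + t *\<^sub>R ln_on E P1)"
  define \<epsilon> where "\<epsilon> n = inverse (real (Suc n))" for n
  have \<epsilon>: "0 < \<epsilon> n" "\<epsilon> n \<le> 1" for n
    by (simp_all add: \<epsilon>_def inverse_le_1_iff)
  have \<epsilon>_lim: "\<epsilon> \<longlonglongrightarrow> 0"
    unfolding \<epsilon>_def by (rule LIMSEQ_inverse_real_of_nat)
  define M where "M P n = (1 - \<epsilon> n) *\<^sub>R P + \<epsilon> n *\<^sub>R Q" for P n
  have M_lumpable: "M P n \<in> lumpable_matrices \<kappa> E'" if "P \<in> lumpable_matrices \<kappa> E" for P n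
    unfolding M_def by (rule mixture_lumpable[OF sub that Q]) (use \<epsilon>[of n] in auto)
  define F where "F n = exp_on E' (s *\<^sub>R ln_on E' (M P0 n) + t *\<^sub>R ln_on E' (M P1 n))" for n
  have F_lumpable: "stochastic_rescaling (F n) \<in> lumpable_matrices \<kappa> E'" for n
  proof -
    have coords: "ln_on E' (M P n) \<in> e_coordinates E' (lumpable_matrices \<kappa> E')"
      if "P \<in> lumpable_matrices \<kappa> E" for P
      using M_lumpable[OF that, of n] lumpable_matrices_iff
      by (blast intro: ln_on_in_e_coordinates[OF E'])
    have "s *\<^sub>R ln_on E' (M P0 n) + t *\<^sub>R ln_on E' (M P1 n)
        \<in> e_coordinates E' (lumpable_matrices \<kappa> E')"
      using affine[unfolded affine_def, rule_format, OF coords[OF P(1)] coords[OF P(2)] st] .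
    then show ?thesis
      by (simp add: F_def e_coordinates_def)
  qed
  have "(\<lambda>n. F n $ y $ z) \<longlonglongrightarrow> L $ y $ z" for y z
  proof -
    consider "(y, z) \<in> E" | "(y, z) \<in> E' - E" | "(y, z) \<notin> E'"
      by blast
    then show ?thesis
    proof cases
      case 1
      have M_lim: "(\<lambda>n. M P n $ y $ z) \<longlonglongrightarrow> P $ y $ z" for P
      proof -
        have "(\<lambda>n. (1 - \<epsilon> n) * P $ y $ z + \<epsilon> n * Q $ y $ z) \<longlonglongrightarrow> (1 - 0) * P $ y $ z + 0 * Q $ y $ z"
          by (intro tendsto_intros \<epsilon>_lim)
        then show ?thesis
          by (simp add: M_def)
      qed
      have "P0 $ y $ z \<noteq> 0" "P1 $ y $ z \<noteq> 0"
        using P 1 by (auto simp: lumpable_matrices_def stochastic_matrices_def pos_fun_space_def)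
      then have "(\<lambda>n. exp (s * ln (M P0 n $ y $ z) + t * ln (M P1 n $ y $ z)))
          \<longlonglongrightarrow> exp (s * ln (P0 $ y $ z) + t * ln (P1 $ y $ z))"
        by (intro tendsto_intros M_lim)
      then show ?thesis
        using 1 sub by (simp add: F_def L_def exp_on_def ln_on_def subset_iff)
    next
      case 2
      have "P0 $ y $ z = 0" "P1 $ y $ z = 0"
        using P 2 by (auto simp: lumpable_matrices_def stochastic_matrices_def pos_fun_space_def
            fun_space_def)
      moreover have "0 < Q $ y $ z"
        using Q 2 by (auto simp: lumpable_matrices_def stochastic_matrices_def pos_fun_space_def)
      \<comment> \<open>Both mixtures have the entry \<open>\<epsilon> * Q\<close>, and the exponents add up to one.\<close>
      ultimately have "F n $ y $ z = \<epsilon> n * Q $ y $ z" for n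
        using 2 st \<epsilon>(1)[of n]
        by (simp add: F_def exp_on_def ln_on_def M_def flip: distrib_right)
      moreover have "(\<lambda>n. \<epsilon> n * Q $ y $ z) \<longlonglongrightarrow> 0"
        using tendsto_mult_left_zero[OF \<epsilon>_lim] .
      ultimately show ?thesis
        using 2 by (simp add: L_def exp_on_def)
    next
      case 3
      then show ?thesis
        using sub by (auto simp: F_def L_def exp_on_def)
    qed
  qed
  then have F_lim: "F \<longlonglongrightarrow> L"
    by (intro vec_tendstoI)
  have F_pos: "F n \<in> pos_fun_space E'" for n
    by (simp add: F_def exp_on_in_pos_fun_space)
  have L_pos: "L \<in> pos_fun_space E"
    by (simp add: L_def exp_on_in_pos_fun_space)
  obtain r where lim: "(\<lambda>n. stochastic_rescaling (F (r n))) \<longlonglongrightarrow> stochastic_rescaling L"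
    using stochastic_rescaling_limit[OF E' F_pos E L_pos F_lim] by blast
  have mass_lim: "(\<lambda>n. row_mass (stochastic_rescaling (F (r n))) y S)
      \<longlonglongrightarrow> row_mass (stochastic_rescaling L) y S" for y S
    unfolding row_mass_def by (intro tendsto_intros lim)
  have "row_mass (stochastic_rescaling L) y1 (fibre \<kappa> x') = row_mass (stochastic_rescaling L) y2 (fibre \<kappa> x')"
    if "\<kappa> y1 = \<kappa> y2" for y1 y2 x'
  proof -
    have "row_mass (stochastic_rescaling (F (r n))) y1 (fibre \<kappa> x')
        = row_mass (stochastic_rescaling (F (r n))) y2 (fibre \<kappa> x')" for n
      using F_lumpable[of "r n"] that unfolding lumpable_matrices_iff by blast
    then show ?thesis
      using LIMSEQ_unique[OF mass_lim[of y1] ] mass_lim[of y2] by simp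
  qed
  then have "stochastic_rescaling L \<in> lumpable_matrices \<kappa> E"
    using stochastic_rescaling_in_stochastic_matrices[OF E L_pos]
    unfolding lumpable_matrices_iff by blast
  then show ?thesis
    by (simp add: L_def)
qed

theorem theorem5p1:
  fixes \<kappa> :: "'y::finite \<Rightarrow> 'x"
    and E E' :: "('y \<times> 'y) set"
  assumes "surj \<kappa>"
    and "edge_set E" and "edge_set E'"
    and "E \<subseteq> E'"
    and "lumpable_matrices \<kappa> E \<noteq> {}"
    and "lumpable_matrices \<kappa> E' \<noteq> {}"
    and "forms_e_family E' (lumpable_matrices \<kappa> E')"
  shows "forms_e_family E (lumpable_matrices \<kappa> E)"
proof (rule e_family_if_affine_e_coordinates)
  let ?V = "lumpable_matrices \<kappa> E"
  show E: "edge_set E" and "?V \<noteq> {}"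
    by fact+
  show V: "?V \<subseteq> stochastic_matrices E"
    by (auto simp: lumpable_matrices_def)
  obtain Q where Q: "Q \<in> lumpable_matrices \<kappa> E'"
    using assms by blast
  show "affine (e_coordinates E ?V)"
    unfolding affine_def
  proof (intro ballI allI impI)
    fix X Y and s t :: real
    assume X: "X \<in> e_coordinates E ?V" and Y: "Y \<in> e_coordinates E ?V" and st: "s + t = 1"
    \<comment> \<open>\<open>p Z\<close> is the representative of \<open>Z\<close> modulo null functions whose exponential is stochastic.\<close>
    define p where "p Z = ln_on E (stochastic_rescaling (exp_on E Z))" for Z
    have diff: "Z - p Z \<in> null_functions E" if Z: "Z \<in> e_coordinates E ?V" for Z
    proof -
      have "stochastic_rescaling (exp_on E Z) \<in> stochastic_matrices E"
        using Z V by (auto simp: e_coordinates_def)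
      then have "stochastic_rescaling (exp_on E (p Z)) = stochastic_rescaling (exp_on E Z)"
        using stochastic_rescaling_of_stochastic[OF E]
        by (simp add: p_def exp_on_ln_on stochastic_matrices_def)
      then show ?thesis
        using rescaling_eq_iff_diff_null[OF E, of Z "p Z"] Z
        by (simp add: e_coordinates_def p_def ln_on_in_fun_space)
    qed
    have "stochastic_rescaling (exp_on E (s *\<^sub>R p X + t *\<^sub>R p Y)) \<in> ?V"
      unfolding p_def
      using lumpable_geodesic[OF E assms(3,4) Q affine_e_coordinates_if_e_family[OF assms(3,7)] _ _ st]
        X Y by (simp add: e_coordinates_def)
    moreover have "s *\<^sub>R p X + t *\<^sub>R p Y \<in> fun_space E"
      unfolding p_def by (intro subspace_add subspace_scale subspace_fun_space ln_on_in_fun_space)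
    ultimately have "s *\<^sub>R p X + t *\<^sub>R p Y \<in> e_coordinates E ?V"
      by (simp add: e_coordinates_def)
    moreover have "s *\<^sub>R (X - p X) + t *\<^sub>R (Y - p Y) \<in> null_functions E"
      using diff X Y by (intro subspace_add subspace_scale subspace_null_functions)
    ultimately have "(s *\<^sub>R p X + t *\<^sub>R p Y) + (s *\<^sub>R (X - p X) + t *\<^sub>R (Y - p Y)) \<in> e_coordinates E ?V"
      by (rule e_coordinates_add_null[OF E])
    then show "s *\<^sub>R X + t *\<^sub>R Y \<in> e_coordinates E ?V"
      by (simp add: algebra_simps)
  qed
qed

end
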